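(* For every $\varepsilon > 0$ there is a constant $c(\varepsilon) > 0$ such that the following holds. Let $n \ge 2$ and $m \ge 1$ be integers, and let $a_1 < \cdots < a_n$ be positive integers such that the set $\{a_1, \ldots, a_n\}$ contains a dissociated set of size $m$. Then $$\log M(a_1, \ldots, a_n) \ge c(\varepsilon)\, \frac{m^{\frac12 - \varepsilon}}{(\log n)^{1/2}}.$$
   Context: For positive integers $a_1 < \cdots < a_n$ define $$M(a_1, \ldots, a_n) = \max_{|z|=1} \prod_{i=1}^n |1 - z^{a_i}|,$$ the maximum being over complex numbers $z$ of modulus 1. A finite set $D = \{\nu_1, \ldots, \nu_m\} \subset \mathbb{Z}$ of $m$ distinct integers is called dissociated if the relation $\varepsilon_1 \nu_1 + \cdots + \varepsilon_m \nu_m = 0$ with all $\varepsilon_i \in \{0, 1, -1\}$ implies $\varepsilon_1 = \cdots = \varepsilon_m = 0$. *)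

theory Defs
  imports "HOL-Analysis.Analysis"
begin

definition max_prod :: "nat \<Rightarrow> (nat \<Rightarrow> nat) \<Rightarrow> real" where
  "max_prod n a = (SUP z\<in>sphere (0::complex) 1. \<Prod>i\<in>{1..n}. norm (1 - z ^ a i))"

text \<open>The supremum is a maximum, since the unit circle is compact.\<close>

lemma max_prod_is_max:
  shows "\<exists>z\<in>sphere (0::complex) 1. max_prod n a = (\<Prod>i\<in>{1..n}. norm (1 - z ^ a i))"
    and "w \<in> sphere (0::complex) 1 \<Longrightarrow> (\<Prod>i\<in>{1..n}. norm (1 - w ^ a i)) \<le> max_prod n a"
proof -
  let ?f = "\<lambda>z::complex. \<Prod>i\<in>{1..n}. norm (1 - z ^ a i)"
  have "\<exists>z\<in>sphere (0::complex) 1. \<forall>w\<in>sphere 0 1. ?f w \<le> ?f z"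
    by (rule continuous_attains_sup) (auto intro!: continuous_intros)
  then obtain z where z: "z \<in> sphere 0 1" "\<And>w. w \<in> sphere 0 1 \<Longrightarrow> ?f w \<le> ?f z"
    by blast
  have eq: "max_prod n a = ?f z"
    unfolding max_prod_def by (rule cSup_eq_maximum) (use z in auto)
  show "\<exists>z\<in>sphere 0 1. max_prod n a = ?f z"
    using z(1) eq by blast
  show "?f w \<le> max_prod n a" if "w \<in> sphere 0 1"
    using z(2)[OF that] eq by simp
qed

definition dissociated :: "int set \<Rightarrow> bool" where
  "dissociated D \<longleftrightarrow> finite D \<and>
     (\<forall>e :: int \<Rightarrow> int. (\<forall>v\<in>D. e v \<in> {0, 1, -1}) \<longrightarrow> (\<Sum>v\<in>D. e v * v) = 0 \<longrightarrow> (\<forall>v\<in>D. e v = 0))"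

end

(* Let f(x) = sum over i of ln |1 - (r e^{ix})^{a_i}| with r < 1. By the maximum modulus principle
   f <= ln M, and since ln |1 - w| = - sum Re (w^k) / k, every nonconstant Fourier coefficient of f
   is <= 0, those at the frequencies v = a_i being at most - r^v / 2. Hence w = ln M - f is
   nonnegative with mean ln M, its L^2 norm is at most ln M + n, and its mean against
   h(x) = sum over v in D of cos(v x) is of order m. As D is dissociated, Riesz products show that h is
   subgaussian with variance m, so h is essentially bounded by a multiple of sqrt (m ln n): the
   exceptional set is polynomially small in n, which the L^2 bound for w absorbs. Thus
   m <= C sqrt (m ln n) ln M, and no loss of m^epsilon occurs.

   Truncating the series makes w a trigonometric polynomial, so that means over the circle can be
   replaced by averages over N-th roots of unity for N large. *)

theory Submission
  imports Defs "HOL-Complex_Analysis.Complex_Analysis" "HOL-Library.Real_Mod"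
begin

section \<open>Averages over roots of unity\<close>

text \<open>The sample points are the arguments of the \<open>N\<close>-th roots of unity. For a
  trigonometric polynomial whose frequencies are all below \<open>N\<close> in absolute value, this
  is exactly its mean over the circle.\<close>

definition circle_avg :: "nat \<Rightarrow> (real \<Rightarrow> real) \<Rightarrow> real" where
  "circle_avg N f = (\<Sum>j<N. f (2 * pi * real j / real N)) / real N"

lemma circle_avg_add: "circle_avg N (\<lambda>x. f x + g x) = circle_avg N f + circle_avg N g"
  by (simp add: circle_avg_def sum.distrib add_divide_distrib)

lemma circle_avg_cmult: "circle_avg N (\<lambda>x. c * f x) = c * circle_avg N f"
  by (simp add: circle_avg_def sum_distrib_left)

lemma circle_avg_sum: "circle_avg N (\<lambda>x. \<Sum>i\<in>I. f i x) = (\<Sum>i\<in>I. circle_avg N (f i))"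
  unfolding circle_avg_def by (subst sum.swap) (simp add: sum_divide_distrib)

lemma circle_avg_const: "N > 0 \<Longrightarrow> circle_avg N (\<lambda>x. c) = c"
  by (simp add: circle_avg_def)

lemma circle_avg_mono: "(\<And>x. f x \<le> g x) \<Longrightarrow> circle_avg N f \<le> circle_avg N g"
  by (simp add: circle_avg_def sum_mono divide_right_mono)

lemma circle_avg_Cauchy_Schwarz:
  assumes "\<And>x. f x \<ge> 0" "\<And>x. g x \<ge> 0"
  shows "circle_avg N (\<lambda>x. f x * g x)
    \<le> sqrt (circle_avg N (\<lambda>x. (f x)\<^sup>2)) * sqrt (circle_avg N (\<lambda>x. (g x)\<^sup>2))"
proof -
  let ?p = "\<lambda>j. 2 * pi * real j / real N"
  have "(\<Sum>j<N. f (?p j) * g (?p j))\<^sup>2 \<le> (\<Sum>j<N. (f (?p j))\<^sup>2) * (\<Sum>j<N. (g (?p j))\<^sup>2)"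
    by (rule Cauchy_Schwarz_ineq_sum)
  then have "(circle_avg N (\<lambda>x. f x * g x))\<^sup>2
      \<le> circle_avg N (\<lambda>x. (f x)\<^sup>2) * circle_avg N (\<lambda>x. (g x)\<^sup>2)"
    unfolding circle_avg_def
    by (simp add: power_divide power2_eq_square[of "real N"] divide_right_mono)
  then show ?thesis
    by (simp add: real_le_rsqrt flip: real_sqrt_mult)
qed

text \<open>A geometric sum whose ratio is an \<open>N\<close>-th root of unity. Sampling cannot
  tell a frequency divisible by \<open>N\<close> from frequency 0, so later lemmas take
  \<open>N\<close> large enough to exclude such aliasing.\<close>

lemma sum_cis_roots_of_unity:
  assumes "N > 0"
  shows "(\<Sum>j<N. cis (of_int k * (2 * pi * real j / real N))) = (if int N dvd k then of_nat N else 0)"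
proof -
  define z where "z = cis (2 * pi * of_int k / real N)"
  have eq: "cis (of_int k * (2 * pi * real j / real N)) = z ^ j" for j
    by (simp add: z_def Complex.DeMoivre algebra_simps)
  have zN: "z ^ N = 1"
    using assms by (auto simp: z_def Complex.DeMoivre cis_eq_1_iff)
  have z1: "z = 1 \<longleftrightarrow> int N dvd k"
  proof
    assume "z = 1"
    then obtain l where "2 * pi * of_int k / real N = of_int l * (2 * pi)"
      by (auto simp: z_def cis_eq_1_iff)
    then have "real_of_int k = real_of_int (int N * l)"
      using assms by (simp add: field_simps)
    then show "int N dvd k" unfolding of_int_eq_iff by simp
  next
    assume "int N dvd k"
    then obtain l where "k = int N * l" ..
    then show "z = 1" using assms by (auto simp: z_def cis_eq_1_iff)
  qed
  show ?thesis
  proof (cases "z = 1")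
    case True
    then show ?thesis unfolding eq using z1 by simp
  next
    case False
    then show ?thesis unfolding eq using z1 zN by (simp add: geometric_sum)
  qed
qed

lemma circle_avg_cos:
  assumes "N > 0"
  shows "circle_avg N (\<lambda>x. cos (of_int k * x)) = (if int N dvd k then 1 else 0)"
proof -
  have "(\<Sum>j<N. cos (of_int k * (2 * pi * real j / real N)))
      = Re (\<Sum>j<N. cis (of_int k * (2 * pi * real j / real N)))"
    by simp
  then show ?thesis
    using assms by (simp only: circle_avg_def sum_cis_roots_of_unity[OF assms]) simp
qed

text \<open>The product splits into cosines of frequencies \<open>p - q\<close> and
  \<open>p + q\<close>. The second lies strictly between 0 and \<open>N\<close>, and the first is a
  multiple of \<open>N\<close> only if it vanishes.\<close>

lemma circle_avg_cos_mult_cos: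
  assumes "p > 0" "q > 0" "p + q < int N"
  shows "circle_avg N (\<lambda>x. cos (of_int p * x) * cos (of_int q * x)) = (if p = q then 1/2 else 0)"
proof -
  have N: "N > 0" using assms by simp
  have "circle_avg N (\<lambda>x. cos (of_int p * x) * cos (of_int q * x))
     = circle_avg N (\<lambda>x. (1/2) * cos (of_int (p - q) * x) + (1/2) * cos (of_int (p + q) * x))"
    by (simp add: cos_times_cos algebra_simps add_divide_distrib)
  also have "\<dots> = (1/2) * (if int N dvd p - q then 1 else 0) + (1/2) * (if int N dvd p + q then 1 else 0)"
    by (simp only: circle_avg_add circle_avg_cmult circle_avg_cos[OF N])
  also have "int N dvd p - q \<longleftrightarrow> p = q"
  proof
    assume "int N dvd p - q"
    then have "p \<noteq> q \<Longrightarrow> int N \<le> \<bar>p - q\<bar>"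
      using dvd_imp_le_int[of "p - q" "int N"] by simp
    then show "p = q" using assms by linarith
  qed simp
  also have "(if int N dvd p + q then 1 else 0) = (0::real)"
    using assms zdvd_not_zless[of "p + q" "int N"] by simp
  finally show ?thesis by (cases "p = q") simp_all
qed

section \<open>Riesz products and subgaussian moments\<close>

text \<open>Expanding the product gives one character for each choice of signs \<open>e v\<close> in
  {0, 1, -1}. Its frequency is below \<open>N\<close> in absolute value, and by dissociation it is 0
  only for the trivial choice, whose coefficient is 1.\<close>

lemma circle_avg_Riesz_product:
  fixes \<tau> :: real
  assumes D: "dissociated D" and N: "(\<Sum>v\<in>D. \<bar>v\<bar>) < int N"
  shows "circle_avg N (\<lambda>x. \<Prod>v\<in>D. 1 + \<tau> * cos (of_int v * x)) = 1"
proof -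
  have fin: "finite D" using D by (simp add: dissociated_def)
  have N0: "N > 0" using N sum_nonneg[of D "\<lambda>v. \<bar>v\<bar>"] by linarith
  \<comment> \<open>\<open>c e\<close> is the coefficient of \<open>cis (e * y)\<close> in
    \<open>1 + \<tau> * cos y\<close>.\<close>
  define c :: "int \<Rightarrow> complex" where "c = (\<lambda>e. if e = 0 then 1 else of_real (\<tau> / 2))"
  \<comment> \<open>Extensional functions make the trivial choice a single element,
    \<open>\<lambda>v\<in>D. 0\<close>.\<close>
  define P where "P = (D \<rightarrow>\<^sub>E {0, 1, -1::int})"
  have finP: "finite P" using fin by (simp add: P_def finite_PiE)
  have factor: "of_real (1 + \<tau> * cos (of_int v * x)) = (\<Sum>e\<in>{0,1,-1}. c e * cis (of_int (e * v) * x))"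
    for v :: int and x
    by (simp add: c_def complex_eq_iff field_simps)
  have "of_real (\<Prod>v\<in>D. 1 + \<tau> * cos (of_int v * x))
     = (\<Sum>e\<in>P. (\<Prod>v\<in>D. c (e v)) * cis (of_int (\<Sum>v\<in>D. e v * v) * x))" for x
  proof -
    have cis: "(\<Prod>v\<in>D. cis (of_int (e v * v) * x)) = cis (of_int (\<Sum>v\<in>D. e v * v) * x)" for e
      using fin by (induction D rule: finite_induct) (simp_all add: cis_mult algebra_simps)
    have "of_real (\<Prod>v\<in>D. 1 + \<tau> * cos (of_int v * x))
        = (\<Prod>v\<in>D. \<Sum>e\<in>{0,1,-1}. c e * cis (of_int (e * v) * x))"
      by (simp only: of_real_prod factor)
    also have "\<dots> = (\<Sum>e\<in>P. \<Prod>v\<in>D. c (e v) * cis (of_int (e v * v) * x))"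
      unfolding P_def by (rule prod_sum_PiE) (use fin in auto)
    finally show ?thesis by (simp only: prod.distrib cis)
  qed
  then have "of_real (\<Sum>j<N. \<Prod>v\<in>D. 1 + \<tau> * cos (of_int v * (2 * pi * real j / real N)))
     = (\<Sum>j<N. \<Sum>e\<in>P. (\<Prod>v\<in>D. c (e v)) * cis (of_int (\<Sum>v\<in>D. e v * v) * (2 * pi * real j / real N)))"
    by (simp only: of_real_sum)
  also have "\<dots> = (\<Sum>e\<in>P. (\<Prod>v\<in>D. c (e v)) * (if int N dvd (\<Sum>v\<in>D. e v * v) then of_nat N else 0))"
    by (subst sum.swap) (simp only: sum_cis_roots_of_unity[OF N0] flip: sum_distrib_left)
  also have "\<dots> = (\<Sum>e\<in>P. if e = (\<lambda>v\<in>D. 0) then of_nat N else 0)"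
  proof (rule sum.cong[OF refl])
    fix e assume e: "e \<in> P"
    then have eD: "\<forall>v\<in>D. e v \<in> {0, 1, -1}" by (auto simp: P_def)
    have "\<bar>\<Sum>v\<in>D. e v * v\<bar> \<le> (\<Sum>v\<in>D. \<bar>v\<bar>)"
      by (rule order_trans[OF sum_abs]) (rule sum_mono, use eD in \<open>auto simp: abs_mult\<close>)
    then have "int N dvd (\<Sum>v\<in>D. e v * v) \<longleftrightarrow> (\<Sum>v\<in>D. e v * v) = 0"
      using N dvd_imp_le_int[of "\<Sum>v\<in>D. e v * v" "int N"] by auto
    also have "\<dots> \<longleftrightarrow> (\<forall>v\<in>D. e v = 0)"
      using D eD by (auto simp: dissociated_def)
    also have "\<dots> \<longleftrightarrow> e = (\<lambda>v\<in>D. 0)"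
      using e by (auto simp: P_def PiE_def extensional_def fun_eq_iff restrict_def)
    finally have iff: "int N dvd (\<Sum>v\<in>D. e v * v) \<longleftrightarrow> e = (\<lambda>v\<in>D. 0)" .
    show "(\<Prod>v\<in>D. c (e v)) * (if int N dvd (\<Sum>v\<in>D. e v * v) then of_nat N else 0)
        = (if e = (\<lambda>v\<in>D. 0) then of_nat N else 0)"
      unfolding iff by (simp add: c_def)
  qed
  also have "\<dots> = complex_of_real (real N)"
    using finP by (subst sum.delta) (auto simp: P_def)
  finally have "(\<Sum>j<N. \<Prod>v\<in>D. 1 + \<tau> * cos (of_int v * (2 * pi * real j / real N))) = real N"
    by (simp only: of_real_eq_iff)
  then show ?thesis using N0 by (simp add: circle_avg_def)
qed

text \<open>By convexity \<open>exp\<close> lies below its chord over [-t, t], and the right-hand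
  side is that chord at \<open>t * u\<close>. Being affine in \<open>u\<close>, it produces the
  factors of a Riesz product.\<close>

lemma exp_mult_le_cosh_sinh:
  fixes t u :: real
  assumes "\<bar>u\<bar> \<le> 1"
  shows "exp (t * u) \<le> cosh t + u * sinh t"
proof -
  have "exp (((1 - (1 + u) / 2)) *\<^sub>R (- t) + ((1 + u) / 2) *\<^sub>R t)
      \<le> (1 - (1 + u) / 2) * exp (- t) + ((1 + u) / 2) * exp t"
    by (rule convex_onD[OF exp_convex]) (use assms in auto)
  moreover have "((1 - (1 + u) / 2)) *\<^sub>R (- t) + ((1 + u) / 2) *\<^sub>R t = t * u"
    by (simp add: field_simps)
  ultimately show ?thesis
    by (simp add: cosh_def sinh_def field_simps)
qed

lemma sinh_le_mult_cosh:
  fixes t :: real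
  assumes "t \<ge> 0"
  shows "sinh t \<le> t * cosh t"
proof -
  have "(\<lambda>x. x * cosh x - sinh x) 0 \<le> (\<lambda>x::real. x * cosh x - sinh x) t"
    by (rule DERIV_nonneg_imp_nondecreasing[OF assms])
       (auto intro!: exI derivative_eq_intros)
  then show ?thesis by simp
qed

text \<open>The derivative of \<open>ln (cosh x)\<close> is \<open>tanh x\<close>, which is at most
  \<open>x\<close> for \<open>x \<ge> 0\<close>; negative arguments follow by evenness.\<close>

lemma cosh_le_exp_square:
  fixes t :: real
  shows "cosh t \<le> exp (t\<^sup>2 / 2)"
proof -
  have *: "cosh t \<le> exp (t\<^sup>2 / 2)" if "t \<ge> 0" for t :: real
  proof -
    have "(\<lambda>x. x\<^sup>2 / 2 - ln (cosh x)) 0 \<le> (\<lambda>x::real. x\<^sup>2 / 2 - ln (cosh x)) t"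
    proof (rule DERIV_nonneg_imp_nondecreasing[OF that])
      fix x :: real assume "0 \<le> x"
      then have "x - sinh x / cosh x \<ge> 0"
        using sinh_le_mult_cosh[of x] by (simp add: field_simps)
      moreover have "((\<lambda>x::real. x\<^sup>2 / 2 - ln (cosh x)) has_real_derivative x - sinh x / cosh x) (at x)"
        by (auto intro!: derivative_eq_intros)
      ultimately show "\<exists>y. ((\<lambda>x::real. x\<^sup>2 / 2 - ln (cosh x)) has_real_derivative y) (at x) \<and> 0 \<le> y"
        by blast
    qed
    then have "ln (cosh t) \<le> t\<^sup>2 / 2" by simp
    then show ?thesis using cosh_real_pos[of t] by (metis exp_le_cancel_iff exp_ln)
  qed
  show ?thesis using *[of t] *[of "- t"] by (cases "t \<ge> 0") auto
qed

text \<open>Bounding each factor by its chord and extracting \<open>cosh t\<close> leaves a Riesz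
  product with \<open>\<tau> = tanh t\<close>, whose average is 1. The cosines thus satisfy the
  moment bound of independent variables.\<close>

lemma circle_avg_exp_dissociated:
  assumes D: "dissociated D" and N: "(\<Sum>v\<in>D. \<bar>v\<bar>) < int N"
  shows "circle_avg N (\<lambda>x. exp (t * (\<Sum>v\<in>D. cos (of_int v * x)))) \<le> exp (real (card D) * t\<^sup>2 / 2)"
proof -
  have fin: "finite D" using D by (simp add: dissociated_def)
  have "exp (t * (\<Sum>v\<in>D. cos (of_int v * x)))
      \<le> cosh t ^ card D * (\<Prod>v\<in>D. 1 + tanh t * cos (of_int v * x))" for x
  proof -
    have "exp (t * (\<Sum>v\<in>D. cos (of_int v * x))) = (\<Prod>v\<in>D. exp (t * cos (of_int v * x)))"
      using fin by (simp add: sum_distrib_left exp_sum)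
    also have "\<dots> \<le> (\<Prod>v\<in>D. cosh t * (1 + tanh t * cos (of_int v * x)))"
    proof (rule prod_mono, intro conjI)
      fix v
      have "exp (t * cos (of_int v * x)) \<le> cosh t + cos (of_int v * x) * sinh t"
        by (rule exp_mult_le_cosh_sinh) simp
      also have "\<dots> = cosh t * (1 + tanh t * cos (of_int v * x))"
        by (simp add: tanh_def field_simps)
      finally show "exp (t * cos (of_int v * x)) \<le> cosh t * (1 + tanh t * cos (of_int v * x))" .
    qed simp
    finally show ?thesis by (simp add: prod.distrib)
  qed
  then have "circle_avg N (\<lambda>x. exp (t * (\<Sum>v\<in>D. cos (of_int v * x))))
     \<le> circle_avg N (\<lambda>x. cosh t ^ card D * (\<Prod>v\<in>D. 1 + tanh t * cos (of_int v * x)))"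
    by (rule circle_avg_mono)
  also have "\<dots> = cosh t ^ card D"
    by (simp add: circle_avg_cmult circle_avg_Riesz_product[OF D N])
  also have "\<dots> \<le> exp (t\<^sup>2 / 2) ^ card D"
    by (intro power_mono cosh_le_exp_square) simp
  finally show ?thesis by (simp flip: exp_of_nat_mult)
qed

section \<open>From correlation with a dissociated set to a lower bound for the mean\<close>

text \<open>Where the cosine sum \<open>h\<close> is at most \<open>lam\<close>, it contributes at
  most \<open>lam * L\<close> to the correlation with \<open>w\<close>. The part above
  \<open>lam\<close> is controlled by exponential moments of \<open>h\<close> and the second moment
  of \<open>w\<close>.\<close>

lemma circle_avg_lower_bound:
  fixes w :: "real \<Rightarrow> real" and n N :: nat
  defines "L \<equiv> circle_avg N w"
  assumes D: "dissociated D" and N: "(\<Sum>v\<in>D. \<bar>v\<bar>) < int N"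
    and card: "1 \<le> card D" "card D \<le> n" and n: "n \<ge> 2"
    and w0: "\<And>x. w x \<ge> 0"
    and w2: "circle_avg N (\<lambda>x. (w x)\<^sup>2) \<le> (L + real n)\<^sup>2"
    and wh: "circle_avg N (\<lambda>x. w x * (\<Sum>v\<in>D. cos (of_int v * x))) \<ge> real (card D) / 4"
  shows "L \<ge> sqrt (real (card D)) / (48 * sqrt (ln (real n)))"
proof -
  define m where "m = real (card D)"
  define l where "l = ln (real n)"
  define h where "h = (\<lambda>x::real. \<Sum>v\<in>D. cos (of_int v * x))"
  \<comment> \<open>The exponent \<open>- s * lam + m * s\<^sup>2\<close> is minimal in
    \<open>s\<close> at \<open>lam / (2 * m)\<close>, with value
    \<open>- lam\<^sup>2 / (4 * m)\<close>. The factor 6 makes this \<open>- 9 * l\<close>, a saving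
    of \<open>n ^ 9\<close>.\<close>
  define lam where "lam = 6 * sqrt (m * l)"
  define s where "s = lam / (2 * m)"
  have m1: "m \<ge> 1" "m \<le> real n" using card by (auto simp: m_def)
  have l: "l \<ge> 1/2"
  proof -
    have "exp (1/2::real) \<le> 2" 
      using exp_half_le2 by simp
    then have "1/2 \<le> ln (2::real)" by (subst ln_ge_iff) auto
    also have "\<dots> \<le> l" using n by (simp add: l_def)
    finally show ?thesis .
  qed
  have N0: "N > 0" using N sum_nonneg[of D "\<lambda>v. \<bar>v\<bar>"] by linarith
  have L0: "L \<ge> 0"
    using circle_avg_mono[of "\<lambda>_. 0" w N] w0 N0 by (simp add: L_def circle_avg_const)
  have sq: "sqrt m \<ge> 1" "sqrt l > 0" using m1 l by auto
  have pos: "lam > 0" "s > 0" using m1 l by (auto simp: lam_def s_def)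
  have lam2: "lam\<^sup>2 = 36 * m * l"
    using m1 l by (simp add: lam_def power_mult_distrib)
  have expo: "- s * lam + m * s\<^sup>2 = - 9 * l"
  proof -
    have "s * lam = lam\<^sup>2 / (2 * m)" by (simp add: s_def power2_eq_square)
    moreover have "m * s\<^sup>2 = lam\<^sup>2 / (4 * m)"
      using m1 by (simp add: s_def power2_eq_square)
    ultimately show ?thesis using m1 by (simp add: lam2)
  qed
  \<comment> \<open>The inequality y \<le> exp y at \<open>y = s * (h x - lam)\<close> replaces a
    case distinction on whether \<open>h x\<close> exceeds \<open>lam\<close>.\<close>
  have pt: "w x * h x \<le> lam * w x + (exp (- s * lam) / s) * (w x * exp (s * h x))" for x
  proof -
    have "s * (h x - lam) \<le> exp (s * (h x - lam))"
      using exp_ge_add_one_self[of "s * (h x - lam)"] by linarith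
    also have "\<dots> = exp (- s * lam) * exp (s * h x)"
      by (simp add: algebra_simps flip: exp_add)
    finally have "h x \<le> lam + (exp (- s * lam) / s) * exp (s * h x)"
      using pos by (simp add: field_simps)
    from mult_left_mono[OF this w0[of x]] show ?thesis by (simp add: algebra_simps)
  qed
  have "m / 4 \<le> circle_avg N (\<lambda>x. w x * h x)" using wh by (simp add: m_def h_def)
  also have "\<dots> \<le> circle_avg N (\<lambda>x. lam * w x + (exp (- s * lam) / s) * (w x * exp (s * h x)))"
    by (rule circle_avg_mono) (rule pt)
  also have "\<dots> = lam * L + (exp (- s * lam) / s) * circle_avg N (\<lambda>x. w x * exp (s * h x))"
    unfolding L_def circle_avg_add circle_avg_cmult ..
  finally have main0: "m / 4 \<le> lam * L + (exp (- s * lam) / s) * circle_avg N (\<lambda>x. w x * exp (s * h x))" .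
  \<comment> \<open>Squaring the exponential doubles its parameter: the moment bound at
    \<open>2 * s\<close> is \<open>exp (2 * m * s\<^sup>2)\<close>, with square root
    \<open>exp (m * s\<^sup>2)\<close>.\<close>
  have "circle_avg N (\<lambda>x. w x * exp (s * h x))
      \<le> sqrt (circle_avg N (\<lambda>x. (w x)\<^sup>2)) * sqrt (circle_avg N (\<lambda>x. (exp (s * h x))\<^sup>2))"
    by (rule circle_avg_Cauchy_Schwarz) (use w0 in auto)
  also have "\<dots> \<le> (L + real n) * exp (m * s\<^sup>2)"
  proof (rule mult_mono)
    show "sqrt (circle_avg N (\<lambda>x. (w x)\<^sup>2)) \<le> L + real n"
      using w2 L0 by (intro real_le_lsqrt) auto
    have "circle_avg N (\<lambda>x. (exp (s * h x))\<^sup>2) \<le> exp (m * (2 * s)\<^sup>2 / 2)"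
      using circle_avg_exp_dissociated[OF D N, of "2 * s"]
      by (simp add: h_def m_def power2_eq_square mult.assoc flip: exp_add)
    also have "\<dots> = (exp (m * s\<^sup>2))\<^sup>2"
      by (simp add: power2_eq_square field_simps flip: exp_add)
    finally show "sqrt (circle_avg N (\<lambda>x. (exp (s * h x))\<^sup>2)) \<le> exp (m * s\<^sup>2)"
      by (intro real_le_lsqrt) auto
  qed (use L0 in \<open>auto simp: circle_avg_def intro!: divide_nonneg_nonneg sum_nonneg\<close>)
  finally have "(exp (- s * lam) / s) * circle_avg N (\<lambda>x. w x * exp (s * h x))
      \<le> (exp (- s * lam) / s) * ((L + real n) * exp (m * s\<^sup>2))"
    by (rule mult_left_mono) (use pos in auto)
  with main0 have main: "m / 4 \<le> lam * L + (exp (- s * lam) / s) * ((L + real n) * exp (m * s\<^sup>2))"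
    by linarith
  have "exp (- s * lam) * exp (m * s\<^sup>2) = 1 / real n ^ 9"
  proof -
    have "exp (- s * lam) * exp (m * s\<^sup>2) = exp (- (9 * l))"
      using expo by (simp flip: exp_add)
    also have "\<dots> = 1 / exp l ^ 9"
      using exp_of_nat_mult[of 9 l] by (simp add: exp_minus inverse_eq_divide)
    finally show ?thesis using n by (simp add: l_def)
  qed
  moreover have "(exp (- s * lam) / s) * ((L + real n) * exp (m * s\<^sup>2))
      = (L + real n) * (exp (- s * lam) * exp (m * s\<^sup>2)) / s" by simp
  ultimately have main': "m / 4 \<le> lam * L + (L + real n) / (s * real n ^ 9)"
    using main by (simp add: mult.commute)
  \<comment> \<open>The constant is 48 = 8 * 6, from \<open>m / 8\<close> and the factor 6 in
    \<open>lam\<close>.\<close>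
  have goal: "sqrt m / (48 * sqrt l) \<le> L" if "m / 8 \<le> lam * L"
  proof -
    have "sqrt m * sqrt m \<le> sqrt m * (48 * sqrt l * L)"
      using m1 that by (simp add: lam_def real_sqrt_mult)
    then have "sqrt m \<le> 48 * sqrt l * L"
      by (rule mult_left_le_imp_le) (use sq in simp)
    then show ?thesis using sq by (simp add: pos_divide_le_eq mult.commute)
  qed
  show ?thesis
  \<comment> \<open>If \<open>L \<le> n\<close>, the error term is at most
    \<open>2 * n / n ^ 8\<close>, so it uses up no more than half of \<open>m / 4\<close>. Otherwise
    \<open>L\<close> exceeds \<open>n \<ge> m \<ge> sqrt m\<close>, which already suffices.\<close>
  proof (cases "L \<le> real n")
    case True
    have s1: "s \<ge> 1 / real n"
    proof -
      have "1 / sqrt m * (3 * sqrt l) = s"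
        using m1 by (simp add: s_def lam_def real_sqrt_mult field_simps)
      moreover have "3 * sqrt l \<ge> 1"
        using real_sqrt_le_mono[of "1/9" l] l by (simp add: real_sqrt_divide)
      moreover have "1 / sqrt m \<ge> 1 / real n"
      proof -
        have "sqrt m \<le> m" using m1 by (simp add: real_le_lsqrt power2_eq_square)
        then show ?thesis using m1 by (simp add: frac_le)
      qed
      ultimately show ?thesis
        using mult_mono[of "1 / real n" "1 / sqrt m" 1 "3 * sqrt l"] sq by simp
    qed
    have n9: "s * real n ^ 9 \<ge> real n ^ 8"
    proof -
      have "real n ^ 8 = 1 / real n * real n ^ 9" using n by (simp add: power_Suc numeral_eq_Suc)
      also have "\<dots> \<le> s * real n ^ 9" by (rule mult_right_mono[OF s1]) simp
      finally show ?thesis .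
    qed
    have "(L + real n) / (s * real n ^ 9) \<le> (2 * real n) / real n ^ 8"
      by (rule frac_le) (use True n9 n in auto)
    also have "\<dots> \<le> 1 / 8"
    proof -
      have "(2::real) ^ 7 \<le> real n ^ 7" using n by (intro power_mono) auto
      then have "16 * real n \<le> real n * real n ^ 7" using n by simp
      then show ?thesis using n by (simp add: field_simps power_Suc numeral_eq_Suc)
    qed
    also have "\<dots> \<le> m / 8" using m1 by simp
    finally have "m / 8 \<le> lam * L" using main' by linarith
    from goal[OF this] show ?thesis by (simp add: m_def l_def)
  next
    case False
    have "sqrt l \<ge> 1/48" using real_sqrt_le_mono[of "1/48\<^sup>2" l] l by (simp add: real_sqrt_divide)
    then have "sqrt m / (48 * sqrt l) \<le> sqrt m / 1" using sq by (intro frac_le) auto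
    also have "\<dots> \<le> m" using m1 by (simp add: real_le_lsqrt power2_eq_square)
    also have "\<dots> \<le> L" using False m1 by simp
    finally show ?thesis by (simp add: m_def l_def)
  qed
qed

section \<open>Second moments of cosine polynomials\<close>

text \<open>Parseval's identity for distinct positive frequencies; keeping them below
  \<open>N / 2\<close> prevents aliasing in the products of pairs.\<close>

lemma circle_avg_cos_sum_square:
  assumes "finite I" "inj_on p I" and p: "\<And>k. k \<in> I \<Longrightarrow> p k > 0 \<and> 2 * p k < int N"
  shows "circle_avg N (\<lambda>x. (\<Sum>k\<in>I. c k * cos (of_int (p k) * x))\<^sup>2) = (\<Sum>k\<in>I. (c k)\<^sup>2) / 2"
proof -
  have "circle_avg N (\<lambda>x. (\<Sum>k\<in>I. c k * cos (of_int (p k) * x))\<^sup>2)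
      = circle_avg N (\<lambda>x. \<Sum>k\<in>I. \<Sum>l\<in>I. (c k * c l) * (cos (of_int (p k) * x) * cos (of_int (p l) * x)))"
    by (simp add: power2_eq_square sum_product mult_ac)
  also have "\<dots> = (\<Sum>k\<in>I. \<Sum>l\<in>I. (c k * c l) * (if p k = p l then 1/2 else 0))"
    unfolding circle_avg_sum circle_avg_cmult
  proof (intro sum.cong refl)
    fix k l assume kl: "k \<in> I" "l \<in> I"
    have "p k > 0" "p l > 0" "p k + p l < int N" using p[OF kl(1)] p[OF kl(2)] by auto
    from circle_avg_cos_mult_cos[OF this]
    show "c k * c l * circle_avg N (\<lambda>x. cos (of_int (p k) * x) * cos (of_int (p l) * x))
        = c k * c l * (if p k = p l then 1/2 else 0)" by simp
  qed
  also have "\<dots> = (\<Sum>k\<in>I. \<Sum>l\<in>I. if k = l then (c k)\<^sup>2 / 2 else 0)"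
    using assms(2) by (intro sum.cong refl) (auto simp: inj_on_eq_iff power2_eq_square)
  also have "\<dots> = (\<Sum>k\<in>I. (c k)\<^sup>2) / 2"
    using assms(1) by (simp add: sum_divide_distrib)
  finally show ?thesis .
qed

lemma sum_inverse_squares_le_2: "(\<Sum>k\<in>{1..<K}. 1 / (real k)\<^sup>2) \<le> 2"
proof -
  \<comment> \<open>The term \<open>- 1 / real (Suc K)\<close> strengthens the claim so that the
    induction telescopes.\<close>
  have "(\<Sum>k\<in>{1..Suc K}. 1 / (real k)\<^sup>2) \<le> 2 - 1 / real (Suc K)"
  proof (induction K)
    case (Suc K)
    have "1 / (real (Suc (Suc K)))\<^sup>2 \<le> 1 / (real (Suc K) * real (Suc (Suc K)))"
      by (rule divide_left_mono) (auto simp: power2_eq_square)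
    also have "\<dots> = 1 / real (Suc K) - 1 / real (Suc (Suc K))"
      by (simp add: divide_simps)
    finally have "1 / (real (Suc (Suc K)))\<^sup>2 \<le> 1 / real (Suc K) - 1 / real (Suc (Suc K))" .
    with Suc show ?case by simp
  qed simp
  moreover have "(\<Sum>k\<in>{1..<K}. 1 / (real k)\<^sup>2) \<le> (\<Sum>k\<in>{1..Suc K}. 1 / (real k)\<^sup>2)"
    by (rule sum_mono2) auto
  moreover have "1 / real (Suc K) \<ge> 0" by simp
  ultimately show ?thesis by linarith
qed

section \<open>Truncated logarithm series and the maximum modulus principle\<close>

text \<open>On the closed disc of radius \<open>r < 1\<close> the series of
  \<open>Ln (1 - w)\<close> converges uniformly by the M-test, so one \<open>K\<close> serves all
  \<open>w\<close>; real parts give the logarithm of the modulus. \<open>K \<ge> 2\<close> retains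
  the linear term.\<close>

lemma ln_norm_one_minus_ge_partial_sum:
  assumes r: "0 \<le> r" "r < 1" and \<eta>: "\<eta> > 0"
  shows "\<exists>K\<ge>2. \<forall>w::complex. norm w \<le> r \<longrightarrow>
           - (\<Sum>k\<in>{1..<K}. Re (w ^ k) / real k) \<le> ln (norm (1 - w)) + \<eta>"
proof -
  define f :: "nat \<Rightarrow> complex \<Rightarrow> complex" where "f = (\<lambda>k w. w ^ k / of_nat k)"
  have sm: "summable (\<lambda>k. r ^ k)" using r by (simp add: summable_geometric)
  have "norm (f k w) \<le> r ^ k" if "w \<in> cball 0 r" for k w
  proof (cases "k = 0")
    case False
    have "norm (f k w) = norm w ^ k / real k" by (simp add: f_def norm_divide norm_power)
    also have "\<dots> \<le> norm w ^ k / 1" by (rule divide_left_mono) (use False in auto)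
    also have "\<dots> \<le> r ^ k" using that by (simp add: power_mono)
    finally show ?thesis .
  qed (simp add: f_def)
  from Weierstrass_m_test[OF this sm]
  have "\<forall>\<^sub>F K in sequentially. \<forall>w\<in>cball 0 r. dist (\<Sum>k<K. f k w) (\<Sum>k. f k w) < \<eta>"
    using \<eta> by (rule uniform_limitD)
  then have "\<forall>\<^sub>F K in sequentially. K \<ge> 2 \<and> (\<forall>w\<in>cball 0 r. dist (\<Sum>k<K. f k w) (\<Sum>k. f k w) < \<eta>)"
    using eventually_ge_at_top[of 2] by eventually_elim auto
  then obtain K where K: "K \<ge> 2" "\<And>w. w \<in> cball 0 r \<Longrightarrow> dist (\<Sum>k<K. f k w) (\<Sum>k. f k w) < \<eta>"
    using eventually_happens by force
  have "- (\<Sum>k\<in>{1..<K}. Re (w ^ k) / real k) \<le> ln (norm (1 - w)) + \<eta>" if w: "norm w \<le> r" for w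
  proof -
    have "norm (- w) < 1" "w \<noteq> 1" using w r by auto
    from Ln_series'[OF this(1)] have "(\<lambda>k. - f k w) sums ln (1 - w)" by (simp add: f_def)
    then have "(\<lambda>k. f k w) sums - ln (1 - w)" using sums_minus by fastforce
    then have suminf: "(\<Sum>k. f k w) = - ln (1 - w)" by (simp add: sums_iff)
    have "(\<Sum>k\<in>{1..<K}. Re (w ^ k) / real k) = Re (\<Sum>k\<in>{1..<K}. f k w)"
      by (simp add: f_def)
    \<comment> \<open>The term \<open>k = 0\<close> vanishes because division by 0 yields 0.\<close>
    also have "(\<Sum>k\<in>{1..<K}. f k w) = (\<Sum>k<K. f k w)"
      by (rule sum.mono_neutral_left) (auto simp: f_def)
    finally have "Re ((\<Sum>k\<in>{..<K}. f k w) - (\<Sum>k. f k w))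
        = (\<Sum>k\<in>{1..<K}. Re (w ^ k) / real k) + ln (norm (1 - w))"
      using \<open>w \<noteq> 1\<close> by (subst suminf) simp
    moreover have "\<bar>Re ((\<Sum>k\<in>{..<K}. f k w) - (\<Sum>k. f k w))\<bar> < \<eta>"
      using K(2)[of w] w abs_Re_le_cmod order.strict_trans1 unfolding dist_norm by (metis mem_cball_0)
    ultimately show ?thesis by linarith
  qed
  with K(1) show ?thesis by blast
qed

lemma prod_norm_le_max_prod:
  fixes z :: complex
  assumes "norm z \<le> 1"
  shows "(\<Prod>i\<in>{1..n}. norm (1 - z ^ a i)) \<le> max_prod n a"
proof -
  have "norm (\<Prod>i\<in>{1..n}. 1 - z ^ a i) \<le> max_prod n a"
    by (rule maximum_modulus_frontier[of "\<lambda>z. \<Prod>i\<in>{1..n}. 1 - z ^ a i" "cball 0 1"])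
       (use assms max_prod_is_max(2)[where n = n and a = a] in
         \<open>auto intro!: holomorphic_intros continuous_intros simp: prod_norm\<close>)
  then show ?thesis by (simp add: prod_norm)
qed

text \<open>At the centre \<open>z = 0\<close> every factor is 1, as the exponents are positive; the
  maximum modulus principle carries this value to the circle.\<close>

lemma max_prod_ge_1:
  assumes "\<forall>i\<in>{1..n}. a i > 0"
  shows "max_prod n a \<ge> 1"
proof -
  have "(\<Prod>i\<in>{1..n}. norm (1 - (0::complex) ^ a i)) = 1"
    by (rule prod.neutral) (metis assms diff_zero norm_one power_0_left not_gr0)
  then show ?thesis using prod_norm_le_max_prod[of 0 a n] by simp
qed

text \<open>Each factor is expanded at \<open>z = r * cis x\<close>, inside the disc, where its
  logarithm is finite and the truncation costs at most \<eta>. The maximum modulus principle then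
  bounds the product.\<close>

lemma cos_poly_le_ln_max_prod:
  assumes r: "0 \<le> r" "r < 1" and \<eta>: "\<eta> > 0" and a: "\<forall>i\<in>{1..n}. a i > 0"
  shows "\<exists>K\<ge>2. \<forall>x. - (\<Sum>i\<in>{1..n}. \<Sum>k\<in>{1..<K}. r ^ (k * a i) / real k * cos (of_int (int (k * a i)) * x))
           \<le> ln (max_prod n a) + real n * \<eta>"
proof -
  obtain K where K: "K \<ge> 2" "\<And>w::complex. norm w \<le> r \<Longrightarrow>
           - (\<Sum>k\<in>{1..<K}. Re (w ^ k) / real k) \<le> ln (norm (1 - w)) + \<eta>"
    using ln_norm_one_minus_ge_partial_sum[OF r \<eta>] by blast
  have "- (\<Sum>i\<in>{1..n}. \<Sum>k\<in>{1..<K}. r ^ (k * a i) / real k * cos (of_int (int (k * a i)) * x))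
           \<le> ln (max_prod n a) + real n * \<eta>" for x
  proof -
    define z where "z = of_real r * cis x"
    have nz: "norm (z ^ a i) \<le> r" if "i \<in> {1..n}" for i
    proof -
      have "norm (z ^ a i) = r ^ a i" using r by (simp add: z_def norm_mult norm_power)
      also have "\<dots> \<le> r ^ 1"
        by (rule power_decreasing) (use a that r in \<open>auto simp: Suc_le_eq Ball_def\<close>)
      finally show ?thesis by simp
    qed
    have pos: "norm (1 - z ^ a i) > 0" if "i \<in> {1..n}" for i
      using nz[OF that] r by auto
    have Re: "Re ((z ^ a i) ^ k) / real k = r ^ (k * a i) / real k * cos (of_int (int (k * a i)) * x)" for i k
    proof -
      have "(z ^ a i) ^ k = of_real (r ^ (k * a i)) * cis (real (k * a i) * x)"
        by (simp add: z_def power_mult_distrib Complex.DeMoivre mult_ac flip: power_mult)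
      then show ?thesis by simp
    qed
    have "(\<Sum>i\<in>{1..n}. - (\<Sum>k\<in>{1..<K}. r ^ (k * a i) / real k * cos (of_int (int (k * a i)) * x)))
        \<le> (\<Sum>i\<in>{1..n}. ln (norm (1 - z ^ a i)) + \<eta>)"
      using K(2)[OF nz] by (intro sum_mono) (simp only: Re)
    also have "\<dots> = ln (\<Prod>i\<in>{1..n}. norm (1 - z ^ a i)) + real n * \<eta>"
    proof -
      have "ln (\<Prod>i\<in>{1..n}. norm (1 - z ^ a i)) = (\<Sum>i\<in>{1..n}. ln (norm (1 - z ^ a i)))"
        using pos by (intro ln_prod) auto
      then show ?thesis by (simp add: sum.distrib)
    qed
    also have "ln (\<Prod>i\<in>{1..n}. norm (1 - z ^ a i)) \<le> ln (max_prod n a)"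
    proof (rule ln_mono)
      show "(\<Prod>i\<in>{1..n}. norm (1 - z ^ a i)) \<le> max_prod n a"
        by (rule prod_norm_le_max_prod) (use r in \<open>simp add: z_def norm_mult\<close>)
      show "(\<Prod>i\<in>{1..n}. norm (1 - z ^ a i)) > 0"
        using pos by (intro prod_pos) auto
    qed
    finally show ?thesis by (simp add: sum_negf)
  qed
  with K(1) show ?thesis by blast
qed

section \<open>The nonnegative polynomial attached to the product\<close>

lemma ln_max_prod_ge:
  assumes n: "n \<ge> 2" and a: "\<forall>i\<in>{1..n}. a i > 0"
    and D: "D \<subseteq> (\<lambda>i. int (a i)) ` {1..n}" "dissociated D" "card D \<ge> 1"
  shows "sqrt (real (card D)) / (48 * sqrt (ln (real n))) \<le> ln (max_prod n a)"
\<comment> \<open>The truncation error \<open>\<epsilon> / n\<close> per factor adds up to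
  \<epsilon>, which is arbitrary.\<close>
proof (rule field_le_epsilon)
  fix \<epsilon> :: real assume \<epsilon>: "\<epsilon> > 0"
  define A where "A = (\<Sum>i\<in>{1..n}. a i)"
  have aA: "a i \<le> A" if "i \<in> {1..n}" for i
    unfolding A_def by (rule member_le_sum) (use that in auto)
  have A0: "A > 0" using aA[of 1] a n by force
  \<comment> \<open>Every \<open>a i\<close> is at most \<open>A\<close>, so this radius keeps all
    weights \<open>r ^ a i\<close> at least 1/2.\<close>
  define r where "r = root A (1/2)"
  have r: "0 \<le> r" "r < 1" using A0 by (auto simp: r_def)
  have rA: "r ^ A = 1/2" using A0 by (simp add: r_def real_root_pow_pos)
  have "\<epsilon> / real n > 0" using \<epsilon> n by simp
  from cos_poly_le_ln_max_prod[OF r this a]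
  obtain K where K: "K \<ge> 2" "\<And>x. - (\<Sum>i\<in>{1..n}. \<Sum>k\<in>{1..<K}. r ^ (k * a i) / real k * cos (of_int (int (k * a i)) * x))
           \<le> ln (max_prod n a) + real n * (\<epsilon> / real n)" by blast
  define L where "L = ln (max_prod n a) + \<epsilon>"
  have L0: "L \<ge> 0" using max_prod_ge_1[OF a] \<epsilon> by (simp add: L_def)
  define c where "c = (\<lambda>i k. r ^ (k * a i) / real k)"
  define p where "p = (\<lambda>i k. int (k * a i))"
  define P where "P = (\<lambda>i x::real. \<Sum>k\<in>{1..<K}. c i k * cos (of_int (p i k) * x))"
  \<comment> \<open>The minus sign of the logarithm series turns the subtraction into a sum with
    coefficients \<open>c i k \<ge> 0\<close>.\<close>
  define w where "w = (\<lambda>x. L + (\<Sum>i\<in>{1..n}. P i x))"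
  have w0: "w x \<ge> 0" for x
    using K(2)[of x] n by (simp add: w_def P_def c_def p_def L_def)
  have fin: "finite D" using D(1) finite_subset by blast
  have cardn: "card D \<le> n"
    using card_mono[OF _ D(1)] card_image_le[of "{1..n}" "\<lambda>i. int (a i)"] by simp
  \<comment> \<open>All \<open>p i k\<close> are at most \<open>K * A\<close> and all
    \<open>v\<close> at most the sum over \<open>D\<close>, so \<open>N\<close> exceeds the sum of
    any two frequencies that get multiplied.\<close>
  define N where "N = nat (2 * int (K * A) + 2 * (\<Sum>v\<in>D. \<bar>v\<bar>) + 1)"
  have N: "int N = 2 * int (K * A) + 2 * (\<Sum>v\<in>D. \<bar>v\<bar>) + 1"
    by (simp add: N_def sum_nonneg)
  have sD: "(\<Sum>v\<in>D. \<bar>v\<bar>) \<ge> 0" by (simp add: sum_nonneg)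
  have ND: "(\<Sum>v\<in>D. \<bar>v\<bar>) < int N" using N sD by linarith
  have N0: "N > 0" using ND sD by linarith
  have p: "p i k > 0" "2 * p i k \<le> 2 * int (K * A)" if "i \<in> {1..n}" "k \<in> {1..<K}" for i k
  proof -
    show "p i k > 0" using that a by (auto simp: p_def)
    have "k * a i \<le> K * A" using that aA by (intro mult_le_mono) auto
    then show "2 * p i k \<le> 2 * int (K * A)" unfolding p_def by linarith
  qed
  have vN: "v > 0" "2 * v < int N - 2 * int (K * A)" if "v \<in> D" for v
  proof -
    show "v > 0" using that D(1) a by auto
    have "\<bar>v\<bar> \<le> (\<Sum>v\<in>D. \<bar>v\<bar>)" by (rule member_le_sum) (use that fin in auto)
    then show "2 * v < int N - 2 * int (K * A)" using N by linarith
  qed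
  have avgP: "circle_avg N (P i) = 0" if i: "i \<in> {1..n}" for i
    unfolding P_def circle_avg_sum circle_avg_cmult
  proof (intro sum.neutral ballI)
    fix k assume k: "k \<in> {1..<K}"
    have "\<not> int N dvd p i k"
      by (rule zdvd_not_zless) (use p[OF i k] N sD in linarith)+
    then show "c i k * circle_avg N (\<lambda>x. cos (of_int (p i k) * x)) = 0"
      by (simp add: circle_avg_cos[OF N0])
  qed
  have avgw: "circle_avg N w = L"
    unfolding w_def circle_avg_add circle_avg_sum using avgP by (simp add: circle_avg_const[OF N0])
  \<comment> \<open>Since \<open>c i k \<le> 1 / k\<close>, Parseval gives at most half the sum of
    the inverse squares.\<close>
  have avgP2: "circle_avg N (\<lambda>x. (P i x)\<^sup>2) \<le> 1" if i: "i \<in> {1..n}" for i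
  proof -
    have "a i > 0" using i a by blast
    then have "inj_on (p i) {1..<K}" by (auto simp: inj_on_def p_def)
    moreover have "p i k > 0 \<and> 2 * p i k < int N" if "k \<in> {1..<K}" for k
      using p[OF i that] N sD by linarith
    ultimately have "circle_avg N (\<lambda>x. (P i x)\<^sup>2) = (\<Sum>k\<in>{1..<K}. (c i k)\<^sup>2) / 2"
      unfolding P_def by (intro circle_avg_cos_sum_square) auto
    also have "(\<Sum>k\<in>{1..<K}. (c i k)\<^sup>2) \<le> (\<Sum>k\<in>{1..<K}. 1 / (real k)\<^sup>2)"
    proof (rule sum_mono)
      fix k assume "k \<in> {1..<K}"
      have "r ^ (k * a i) \<le> 1" using r by (intro power_le_one) auto
      then have "(r ^ (k * a i))\<^sup>2 \<le> 1" using r by (intro power_le_one) auto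
      then show "(c i k)\<^sup>2 \<le> 1 / (real k)\<^sup>2"
        by (simp add: c_def power_divide divide_right_mono)
    qed
    also have "\<dots> \<le> 2" by (rule sum_inverse_squares_le_2)
    finally show ?thesis by simp
  qed
  have avgw2: "circle_avg N (\<lambda>x. (w x)\<^sup>2) \<le> (L + real n)\<^sup>2"
  proof -
    have "circle_avg N (\<lambda>x. (w x)\<^sup>2)
        = circle_avg N (\<lambda>x. (L\<^sup>2 + 2 * L * (\<Sum>i\<in>{1..n}. P i x)) + (\<Sum>i\<in>{1..n}. P i x)\<^sup>2)"
      by (simp add: w_def power2_sum algebra_simps)
    also have "\<dots> = L\<^sup>2 + circle_avg N (\<lambda>x. (\<Sum>i\<in>{1..n}. P i x)\<^sup>2)"
      unfolding circle_avg_add circle_avg_cmult circle_avg_sum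
      using avgP by (simp add: circle_avg_const[OF N0])
    \<comment> \<open>Different \<open>P i\<close> may share frequencies, so Parseval is used for
      each \<open>i\<close> separately and Cauchy-Schwarz combines them at the cost of a factor
      \<open>n\<close>.\<close>
    also have "circle_avg N (\<lambda>x. (\<Sum>i\<in>{1..n}. P i x)\<^sup>2)
        \<le> circle_avg N (\<lambda>x. real n * (\<Sum>i\<in>{1..n}. (P i x)\<^sup>2))"
    proof (rule circle_avg_mono)
      fix x
      show "(\<Sum>i\<in>{1..n}. P i x)\<^sup>2 \<le> real n * (\<Sum>i\<in>{1..n}. (P i x)\<^sup>2)"
        using sum_squared_le_sum_of_squares[of "\<lambda>i. P i x" "{1..n}"] by (simp add: mult.commute)
    qed
    also have "\<dots> = real n * (\<Sum>i\<in>{1..n}. circle_avg N (\<lambda>x. (P i x)\<^sup>2))"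
      unfolding circle_avg_cmult circle_avg_sum ..
    also have "\<dots> \<le> real n * real n"
      using sum_mono[of "{1..n}" "\<lambda>i. circle_avg N (\<lambda>x. (P i x)\<^sup>2)" "\<lambda>_. 1"] avgP2
      by (intro mult_left_mono) auto
    also have "L\<^sup>2 + real n * real n \<le> (L + real n)\<^sup>2"
      using L0 by (simp add: power2_sum flip: power2_eq_square)
    finally show ?thesis by simp
  qed
  \<comment> \<open>All contributions are nonnegative, so the single term \<open>i = j\<close>,
    \<open>k = 1\<close> suffices: it has weight at least 1/2, and the average of the squared cosine
    is 1/2.\<close>
  have avgwv: "circle_avg N (\<lambda>x. w x * cos (of_int v * x)) \<ge> 1/4" if v: "v \<in> D" for v
  proof -
    obtain j where j: "j \<in> {1..n}" "v = int (a j)" using v D(1) by auto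
    have cc: "circle_avg N (\<lambda>x. cos (of_int (p i k) * x) * cos (of_int v * x)) = (if p i k = v then 1/2 else 0)"
      if "i \<in> {1..n}" "k \<in> {1..<K}" for i k
    proof (rule circle_avg_cos_mult_cos)
      show "p i k + v < int N" using p(2)[OF that] vN[OF v] by linarith
    qed (use p[OF that] vN[OF v] in auto)
    have "\<not> int N dvd v"
    proof (rule zdvd_not_zless)
      show "v < int N" using vN[OF v] by linarith
    qed (use vN[OF v] in auto)
    then have cv: "circle_avg N (\<lambda>x. cos (of_int v * x)) = 0" by (simp add: circle_avg_cos[OF N0])
    have c0: "c i k \<ge> 0" for i k using r by (simp add: c_def)
    have "circle_avg N (\<lambda>x. w x * cos (of_int v * x))
       = circle_avg N (\<lambda>x. L * cos (of_int v * x)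
           + (\<Sum>i\<in>{1..n}. \<Sum>k\<in>{1..<K}. c i k * (cos (of_int (p i k) * x) * cos (of_int v * x))))"
      by (simp add: w_def P_def distrib_right sum_distrib_right mult.assoc)
    also have "\<dots> = (\<Sum>i\<in>{1..n}. \<Sum>k\<in>{1..<K}. c i k * (if p i k = v then 1/2 else 0))"
      unfolding circle_avg_add circle_avg_cmult circle_avg_sum cv using cc by simp
    finally have eq: "circle_avg N (\<lambda>x. w x * cos (of_int v * x))
        = (\<Sum>i\<in>{1..n}. \<Sum>k\<in>{1..<K}. c i k * (if p i k = v then 1/2 else 0))" .
    have "1/4 \<le> r ^ a j / 2"
      using power_decreasing[OF aA[OF j(1)], of r] r rA by simp
    also have "\<dots> = c j 1 * (if p j 1 = v then 1/2 else 0)"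
      by (simp add: c_def p_def j(2))
    also have "\<dots> \<le> (\<Sum>k\<in>{1..<K}. c j k * (if p j k = v then 1/2 else 0))"
      by (rule member_le_sum) (use K(1) c0 in auto)
    also have "\<dots> \<le> (\<Sum>i\<in>{1..n}. \<Sum>k\<in>{1..<K}. c i k * (if p i k = v then 1/2 else 0))"
      by (rule member_le_sum[OF j(1)]) (auto intro!: sum_nonneg c0)
    finally show ?thesis by (simp only: eq)
  qed
  have "circle_avg N (\<lambda>x. w x * (\<Sum>v\<in>D. cos (of_int v * x)))
      = (\<Sum>v\<in>D. circle_avg N (\<lambda>x. w x * cos (of_int v * x)))"
    by (simp add: sum_distrib_left circle_avg_sum)
  moreover have "(\<Sum>v\<in>D. 1/4) \<le> (\<Sum>v\<in>D. circle_avg N (\<lambda>x. w x * cos (of_int v * x)))"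
    by (rule sum_mono) (rule avgwv)
  ultimately have avgwh: "circle_avg N (\<lambda>x. w x * (\<Sum>v\<in>D. cos (of_int v * x))) \<ge> real (card D) / 4"
    by simp
  have "sqrt (real (card D)) / (48 * sqrt (ln (real n))) \<le> circle_avg N w"
    by (rule circle_avg_lower_bound[OF D(2) ND D(3) cardn n w0 _ avgwh]) (simp only: avgw avgw2)
  then show "sqrt (real (card D)) / (48 * sqrt (ln (real n))) \<le> ln (max_prod n a) + \<epsilon>"
    by (simp add: avgw L_def)
qed

theorem proposition1p3:
  shows "\<forall>\<epsilon>::real. \<epsilon> > 0 \<longrightarrow> (\<exists>c::real. c > 0 \<and>
    (\<forall>(n::nat) (m::nat) (a :: nat \<Rightarrow> nat).
       n \<ge> 2 \<longrightarrow> m \<ge> 1 \<longrightarrow>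
       (\<forall>i\<in>{1..n}. a i > 0) \<longrightarrow> strict_mono_on {1..n} a \<longrightarrow>
       (\<exists>D \<subseteq> (\<lambda>i. int (a i)) ` {1..n}. dissociated D \<and> card D = m) \<longrightarrow>
       ln (max_prod n a) \<ge> c * (real m powr (1/2 - \<epsilon>) / sqrt (ln (real n)))))"
proof (intro allI impI exI[of _ "1/48::real"] conjI)
  \<comment> \<open>The witness 1/48 serves every \<epsilon>, since \<open>m \<ge> 1\<close> makes
    \<open>m powr (1/2 - \<epsilon>)\<close> at most \<open>sqrt m\<close>.\<close>
  fix \<epsilon> :: real and n m :: nat and a :: "nat \<Rightarrow> nat"
  assume \<epsilon>: "\<epsilon> > 0" and n: "n \<ge> 2" and m: "m \<ge> 1" and a: "\<forall>i\<in>{1..n}. a i > 0"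
    and "\<exists>D \<subseteq> (\<lambda>i. int (a i)) ` {1..n}. dissociated D \<and> card D = m"
  then obtain D where D: "D \<subseteq> (\<lambda>i. int (a i)) ` {1..n}" "dissociated D" "card D = m" by blast
  have "real m powr (1/2 - \<epsilon>) \<le> real m powr (1/2)"
    using m \<epsilon> by (intro powr_mono) auto
  also have "\<dots> = sqrt (real m)" by (simp add: powr_half_sqrt)
  finally have "1/48 * (real m powr (1/2 - \<epsilon>) / sqrt (ln (real n)))
      \<le> 1/48 * (sqrt (real m) / sqrt (ln (real n)))"
    using n by (intro mult_left_mono divide_right_mono) auto
  also have "\<dots> \<le> ln (max_prod n a)"
    using ln_max_prod_ge[OF n a D(1,2)] m D(3) by simp
  finally show "1/48 * (real m powr (1/2 - \<epsilon>) / sqrt (ln (real n))) \<le> ln (max_prod n a)" .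
qed simp

end
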